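(* Let $\mu_1 : \mathbb{N}^+ \times \mathbb{N}^+ \to \mathbb{Z}$ denote the Möbius function of the floor quotient order. Let $\alpha_0 \approx 1.729$ denote the unique positive real number with $\zeta(\alpha_0) = 2$, where $\zeta(s)$ is the Riemann zeta function. Then $$|\mu_1(d,n)| \le \left( \frac{n}{d} \right)^{\alpha_0} \quad \text{for all } d,n \in \mathbb{N}^+.$$
   Context: $\mathbb{N}^+ = \{1,2,3,\ldots\}$. For positive integers $d,n$, $d$ is a floor quotient of $n$, written $d \preccurlyeq_1 n$, if $d = \lfloor n/k \rfloor$ for some positive integer $k$; this relation is a partial order on $\mathbb{N}^+$. Its two-variable Möbius function $\mu_1$ is the unique function $\mathbb{N}^+ \times \mathbb{N}^+ \to \mathbb{Z}$ with $\mu_1(n,n)=1$ for all $n$, $\mu_1(d,n)=0$ if $d \not\preccurlyeq_1 n$, and $\sum_{m:\, d \preccurlyeq_1 m \preccurlyeq_1 n} \mu_1(d,m) = 0$ for all $d \ne n$. *)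

theory Defs
  imports "HOL-Complex_Analysis.Complex_Analysis"
begin

text \<open>
  The positive integers are modelled by the positive elements of \<^typ>\<open>nat\<close>; the relation is
  false as soon as one argument is \<open>0\<close>. On natural numbers, \<open>n div k\<close> is the floor of \<open>n / k\<close>.
\<close>

definition floor_quotient :: "nat \<Rightarrow> nat \<Rightarrow> bool" (infix "\<preceq>\<^sub>1" 50) where
  "d \<preceq>\<^sub>1 n \<longleftrightarrow> d > 0 \<and> n > 0 \<and> (\<exists>k>0. d = n div k)"

text \<open>
  Since \<open>\<preceq>\<^sub>1\<close> fails when an argument is \<open>0\<close>, the second clause also fixes the value \<open>0\<close> outside
  the positive integers, which makes the function unique as a function on all of \<^typ>\<open>nat\<close>; the
  third clause is an empty sum there. The index set of the sum is finite because
  \<open>m \<preceq>\<^sub>1 n\<close> implies \<open>m \<le> n\<close>.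
\<close>

definition floor_quotient_mobius :: "nat \<Rightarrow> nat \<Rightarrow> int" ("\<mu>\<^sub>1") where
  "\<mu>\<^sub>1 = (THE \<mu>.
     (\<forall>n>0. \<mu> n n = 1) \<and>
     (\<forall>d n. \<not> d \<preceq>\<^sub>1 n \<longrightarrow> \<mu> d n = 0) \<and>
     (\<forall>d n. d \<noteq> n \<longrightarrow> (\<Sum>m | d \<preceq>\<^sub>1 m \<and> m \<preceq>\<^sub>1 n. \<mu> d m) = 0))"

text \<open>
  The analytic continuation to the plane without \<open>1\<close> of the Dirichlet series. The value at the
  pole is an arbitrary convention that makes the function unique.
\<close>

definition riemann_zeta :: "complex \<Rightarrow> complex" where
  "riemann_zeta = (THE f.
     f holomorphic_on (- {1}) \<and>
     (\<forall>s. Re s > 1 \<longrightarrow> (\<lambda>n. 1 / of_nat (Suc n) powr s) sums f s) \<and>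
     f 1 = 0)"

definition alpha0 :: real ("\<alpha>\<^sub>0") where
  "\<alpha>\<^sub>0 = (THE a. a > 0 \<and> riemann_zeta (of_real a) = 2)"

end

theory Submission
  imports Defs
begin

text \<open>
  Solved for its last term, the defining equation of the Moebius function says that, for \<open>d\<close> a floor
  quotient of \<open>n\<close> and \<open>d \<noteq> n\<close>, \<open>\<mu>\<^sub>1 d n\<close> is minus the sum of \<open>\<mu>\<^sub>1 d m\<close> over the floor quotients \<open>m < n\<close>
  of \<open>n\<close> that have \<open>d\<close> as a floor quotient. Each such \<open>m\<close> is \<open>n div k\<close> for some \<open>k \<ge> 2\<close>, with different
  \<open>k\<close> for different \<open>m\<close>, and \<open>m \<le> n / k\<close>. Induction on \<open>n\<close> therefore bounds \<open>\<bar>\<mu>\<^sub>1 d n\<bar>\<close> by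
  \<open>(n / d) powr \<alpha>\<^sub>0\<close> times the sum of \<open>k powr (- \<alpha>\<^sub>0)\<close> over \<open>k \<ge> 2\<close>. The latter sum is
  \<open>\<zeta>(\<alpha>\<^sub>0) - 1 = 1\<close> (\<open>sum_powr_alpha0_le\<close>), so the induction closes.

  The three constants of the statement are definite descriptions, and it has to be shown that each
  of them denotes. For the Moebius function the recursion just described is the unique solution of
  the defining equations (\<open>floor_quotient_mobius_eq\<close>).

  For the zeta function, an analytic continuation to the whole punctured plane is needed. It is
  obtained without contour integrals or a functional equation. Expanding the telescoping
  differences \<open>(n + 2) powr (1 - s) - (n + 1) powr (1 - s)\<close> in powers of \<open>n + 1\<close> and summing over \<open>n\<close>
  expresses \<open>(s - 1) \<zeta>(s)\<close> by the same function at \<open>s + 1, \<dots>, s + K\<close> and a series of Taylor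
  remainders that converges for \<open>Re s > - K\<close> (\<open>dirichlet_zeta_shift_recurrence\<close>). This extends
  \<open>(s - 1) \<zeta>(s)\<close> from one half-plane to the next and, in the limit, to an entire function.

  For \<open>\<alpha>\<^sub>0\<close>, the case \<open>K = 0\<close> of the same formula shows that \<open>\<zeta>(a) - 1 / (a - 1)\<close> lies between \<open>0\<close> and
  \<open>1\<close> for all real \<open>a > 0\<close> other than \<open>1\<close> (\<open>riemann_zeta_real_bounds\<close>). This locates a solution of
  \<open>\<zeta>(a) = 2\<close> between \<open>3/2\<close> and \<open>2\<close> and excludes solutions below \<open>1\<close>; beyond \<open>1\<close> strict monotonicity
  of the Dirichlet series gives uniqueness.
\<close>

section \<open>Analytic continuation of the Riemann zeta function\<close>

definition dirichlet_zeta :: "complex \<Rightarrow> complex" where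
  "dirichlet_zeta s = (\<Sum>n. 1 / of_nat (Suc n) powr s)"

text \<open>
  The remainder of the binomial expansion of \<open>(x + 1) powr (1 - s)\<close> in powers of \<open>x\<close>, at
  \<open>x = n + 1\<close>, cut after the term of order \<open>K + 1\<close>. It decays like \<open>n powr (- Re s - K - 1)\<close>,
  so its sum over \<open>n\<close> converges on the half-plane \<open>Re s > - K\<close>.
\<close>

definition zeta_tail :: "nat \<Rightarrow> nat \<Rightarrow> complex \<Rightarrow> complex" where
  "zeta_tail K n s = of_nat (Suc (Suc n)) powr (1 - s)
     - (\<Sum>k\<le>Suc K. ((1 - s) gchoose k) * of_nat (Suc n) powr (1 - s - of_nat k))"

lemma norm_of_nat_powr: "cmod (of_nat (Suc n) powr z) = real (Suc n) powr Re z"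
  by (subst norm_powr_real_powr) auto

lemma summable_Suc_powr: "p < -1 \<Longrightarrow> summable (\<lambda>n. real (Suc n) powr p)"
  using summable_Suc_iff[of "\<lambda>n. real n powr p"] summable_real_powr_iff[of p] by simp

lemma dirichlet_zeta_sums:
  assumes "Re s > 1"
  shows "(\<lambda>n. 1 / of_nat (Suc n) powr s) sums dirichlet_zeta s"
proof -
  have "summable (\<lambda>n. 1 / of_nat (Suc n) powr s)"
  proof (rule summable_comparison_test[OF _ summable_Suc_powr])
    show "\<exists>N. \<forall>n\<ge>N. cmod (1 / of_nat (Suc n) powr s) \<le> real (Suc n) powr (- Re s)"
      unfolding norm_divide norm_of_nat_powr norm_one powr_minus_divide by simp
    show "- Re s < - 1" using assms by simp
  qed
  then show ?thesis unfolding dirichlet_zeta_def by (rule summable_sums)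
qed

text \<open>
  Taylor's formula on the segment from \<open>n + 1\<close> to \<open>n + 2\<close>. The product is the falling factorial
  that comes with the derivative of order \<open>K + 2\<close>; the hypothesis makes the remaining exponent
  negative, so that the derivative is largest at \<open>n + 1\<close>.
\<close>

lemma norm_zeta_tail_le:
  assumes "Re s > - real K"
  shows "cmod (zeta_tail K n s) \<le>
    cmod (\<Prod>i<Suc (Suc K). 1 - s - of_nat i) * real (Suc n) powr (- Re s - real K - 1)"
proof -
  \<comment> \<open>\<open>f i\<close> is the \<open>i\<close>-th derivative of \<open>z powr (1 - s)\<close>.\<close>
  define f :: "nat \<Rightarrow> complex \<Rightarrow> complex" where
    "f = (\<lambda>i z. (\<Prod>j<i. 1 - s - of_nat j) * z powr (1 - s - of_nat i))"
  define B where "B = cmod (\<Prod>i<Suc (Suc K). 1 - s - of_nat i) * real (Suc n) powr (- Re s - real K - 1)"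
  define S where "S = closed_segment (of_nat (Suc n) :: complex) (of_nat (Suc (Suc n)))"
  have S: "\<exists>x. z = of_real x \<and> real (Suc n) \<le> x" if z: "z \<in> S" for z
  proof -
    obtain u where u: "0 \<le> u" "z = (1 - u) *\<^sub>R of_nat (Suc n) + u *\<^sub>R of_nat (Suc (Suc n))"
      using z unfolding S_def in_segment by metis
    have "z = of_real (real (Suc n) + u)" unfolding u(2) by (simp add: scaleR_conv_of_real algebra_simps)
    moreover have "real (Suc n) \<le> real (Suc n) + u" using u(1) by linarith
    ultimately show ?thesis by metis
  qed
  have "cmod (f 0 (of_nat (Suc (Suc n))) - (\<Sum>i\<le>Suc K. f i (of_nat (Suc n)) *
      (of_nat (Suc (Suc n)) - of_nat (Suc n)) ^ i / fact i))
      \<le> B * cmod (of_nat (Suc (Suc n)) - of_nat (Suc n)) ^ Suc (Suc K) / fact (Suc K)"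
  proof (rule complex_Taylor[of S])
    show "convex S" unfolding S_def by simp
    fix i z assume z: "z \<in> S"
    obtain x where x: "z = of_real x" "real (Suc n) \<le> x" using S[OF z] by blast
    then have "z \<notin> \<real>\<^sub>\<le>\<^sub>0" by auto
    then have *: "((\<lambda>z. z powr (1 - s - of_nat i)) has_field_derivative
        (1 - s - of_nat i) * z powr (1 - s - of_nat i - 1)) (at z)"
      by (rule has_field_derivative_powr)
    have "(f i has_field_derivative (\<Prod>j<i. 1 - s - of_nat j) *
        ((1 - s - of_nat i) * z powr (1 - s - of_nat i - 1))) (at z within S)"
      unfolding f_def
      by (rule DERIV_cmult[OF has_field_derivative_at_within[OF *]])
    also have "(\<Prod>j<i. 1 - s - of_nat j) * ((1 - s - of_nat i) * z powr (1 - s - of_nat i - 1)) = f (Suc i) z"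
    proof -
      have "1 - s - of_nat (Suc i) = 1 - s - of_nat i - 1" by simp
      then show ?thesis unfolding f_def by (simp only: prod.lessThan_Suc mult.assoc)
    qed
    finally show "(f i has_field_derivative f (Suc i) z) (at z within S)" .
  next
    fix z assume z: "z \<in> S"
    obtain x where x: "z = of_real x" "real (Suc n) \<le> x" using S[OF z] by blast
    have "cmod (z powr (1 - s - of_nat (Suc (Suc K)))) = x powr (- Re s - real K - 1)"
      using x by (subst norm_powr_real_powr) auto
    also have "\<dots> \<le> real (Suc n) powr (- Re s - real K - 1)"
      using x assms by (intro powr_mono2') auto
    finally show "cmod (f (Suc (Suc K)) z) \<le> B"
      unfolding f_def B_def norm_mult by (rule mult_left_mono) (rule norm_ge_zero)
  qed (auto simp: S_def)
  also have "f 0 (of_nat (Suc (Suc n))) - (\<Sum>i\<le>Suc K. f i (of_nat (Suc n)) *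
      (of_nat (Suc (Suc n)) - of_nat (Suc n)) ^ i / fact i) = zeta_tail K n s"
    unfolding f_def zeta_tail_def
    by (simp add: gbinomial_prod_rev atLeast0LessThan del: sum.atMost_Suc)
  also have "B * cmod (of_nat (Suc (Suc n)) - of_nat (Suc n)) ^ Suc (Suc K) / fact (Suc K)
      = B / fact (Suc K)" by (simp del: fact_Suc)
  also have "\<dots> \<le> B"
  proof -
    have "0 \<le> B" unfolding B_def by (intro mult_nonneg_nonneg norm_ge_zero powr_ge_zero)
    then have "B / fact (Suc K) \<le> B / 1" by (rule divide_left_mono[OF fact_ge_1]) simp
    then show ?thesis by simp
  qed
  finally show ?thesis unfolding B_def .
qed

lemma zeta_tail_series:
  shows "(\<lambda>s. \<Sum>n. zeta_tail K n s) holomorphic_on {s. Re s > - real K}"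
    and "Re s > - real K \<Longrightarrow> summable (\<lambda>n. zeta_tail K n s)"
proof -
  let ?S = "{s. Re s > - real K}"
  have op: "open ?S" by (rule open_halfspace_Re_gt)
  have hol: "zeta_tail K n holomorphic_on A" for n A
    unfolding zeta_tail_def gbinomial_prod_rev by (intro holomorphic_intros) auto
  obtain g where g: "\<forall>s\<in>?S. (\<lambda>n. zeta_tail K n s) sums g s \<and> g field_differentiable at s"
  proof (rule series_differentiable_comparison_complex[OF op])
    show "zeta_tail K n field_differentiable at s" for n s
      using hol[of n UNIV] holomorphic_on_imp_differentiable_at by blast
    fix s assume s: "s \<in> ?S"
    \<comment> \<open>Half the distance to the boundary line: on this ball the exponent is at most
       \<open>- c - K - 1 < - 1\<close>, which gives a convergent majorant.\<close>
    define d where "d = (Re s + real K) / 2"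
    define c where "c = Re s - d"
    have d: "d > 0" and c: "c > - real K" using s by (auto simp: d_def c_def field_simps)
    have "compact ((\<lambda>s. \<Prod>i<Suc (Suc K). 1 - s - of_nat i) ` cball s d)"
      by (intro compact_continuous_image continuous_intros compact_cball)
    then obtain C where C: "\<And>z. z \<in> cball s d \<Longrightarrow> cmod (\<Prod>i<Suc (Suc K). 1 - z - of_nat i) \<le> C"
      by (meson compact_imp_bounded bounded_iff imageI)
    have C0: "C \<ge> 0" using C[of s] d by (meson centre_in_cball less_imp_le norm_ge_zero order_trans)
    define h :: "nat \<Rightarrow> complex" where "h = (\<lambda>n. of_real (C * real (Suc n) powr (- c - real K - 1)))"
    have "summable (\<lambda>n. C * real (Suc n) powr (- c - real K - 1))"
      using c by (intro summable_mult summable_Suc_powr) auto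
    then have 1: "summable h" unfolding h_def by (rule summable_of_real)
    have 2: "range h \<subseteq> \<real>\<^sub>\<ge>\<^sub>0" using C0 unfolding h_def by auto
    have 3: "cmod (zeta_tail K n z) \<le> cmod (h n)" if "z \<in> ball s d" for n z
    proof -
      have "\<bar>Re (s - z)\<bar> \<le> cmod (s - z)" by (rule abs_Re_le_cmod)
      then have Rez: "Re z \<ge> c" using that by (auto simp: c_def dist_norm)
      have "cmod (zeta_tail K n z) \<le>
        cmod (\<Prod>i<Suc (Suc K). 1 - z - of_nat i) * real (Suc n) powr (- Re z - real K - 1)"
        using Rez c by (intro norm_zeta_tail_le) auto
      also have "\<dots> \<le> C * real (Suc n) powr (- c - real K - 1)"
        using Rez that C0 by (intro mult_mono C powr_mono) auto
      also have "\<dots> = cmod (h n)" using C0 unfolding h_def norm_of_real by simp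
      finally show ?thesis .
    qed
    show "\<exists>d h. 0 < d \<and> summable h \<and> range h \<subseteq> \<real>\<^sub>\<ge>\<^sub>0 \<and>
       (\<forall>\<^sub>F n in sequentially. \<forall>y\<in>ball s d \<inter> ?S. cmod (zeta_tail K n y) \<le> cmod (h n))"
      using 1 2 3 d by (intro exI[of _ d] exI[of _ h]) auto
  qed
  show "Re s > - real K \<Longrightarrow> summable (\<lambda>n. zeta_tail K n s)"
    using g sums_summable by blast
  have "g holomorphic_on ?S" using g by (auto simp: holomorphic_on_open op field_differentiable_def)
  moreover have "g s = (\<Sum>n. zeta_tail K n s)" if "s \<in> ?S" for s
    using g that by (simp add: sums_iff)
  ultimately show "(\<lambda>s. \<Sum>n. zeta_tail K n s) holomorphic_on ?S"
    using holomorphic_cong[of ?S ?S g "\<lambda>s. \<Sum>n. zeta_tail K n s"] by simp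
qed

text \<open>
  Summed over \<open>n\<close>, the differences \<open>(n + 2) powr (1 - s) - (n + 1) powr (1 - s)\<close> telescope to \<open>-1\<close>.
  Expanded in powers of \<open>n + 1\<close>, they also sum to a combination of \<open>\<zeta>(s), \<zeta>(s + 1), \<dots>\<close> plus the
  tails. The coefficient \<open>(1 - s) gchoose Suc j\<close> of \<open>\<zeta>(s + j)\<close> has the factor \<open>- (s + j - 1)\<close>, which
  cancels the pole of \<open>\<zeta>\<close> at \<open>s + j = 1\<close>. So the relation is stated between values of
  \<open>(s - 1) \<zeta>(s)\<close>, and the value at \<open>s\<close> is expressed by values further to the right.
\<close>

lemma dirichlet_zeta_shift_recurrence:
  assumes s: "Re s > 1"
  shows "(s - 1) * dirichlet_zeta s = 1 + (\<Sum>n. zeta_tail K n s)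
    - (\<Sum>j=1..K. ((1 - s) gchoose j) / of_nat (Suc j) *
         ((s + of_nat j - 1) * dirichlet_zeta (s + of_nat j)))"
proof -
  let ?c = "\<lambda>j. ((1 - s) gchoose j) / of_nat (Suc j) *
         ((s + of_nat j - 1) * dirichlet_zeta (s + of_nat j))"
  have move: "(- p * q / r) * D = - (q / r * (p * D))" for p q r D :: complex
    by simp
  have c: "((1 - s) gchoose Suc j) * dirichlet_zeta (s + of_nat j) = - ?c j" for j
  proof -
    have "of_nat (Suc j) * ((1 - s) gchoose Suc j) = (1 - s - of_nat j) * ((1 - s) gchoose j)"
      using gbinomial_mult_1[of "1 - s" j] by (simp add: algebra_simps)
    then have "((1 - s) gchoose Suc j) = (1 - s - of_nat j) * ((1 - s) gchoose j) / of_nat (Suc j)"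
      by (metis nonzero_mult_div_cancel_left of_nat_neq_0)
    also have "1 - s - of_nat j = - (s + of_nat j - 1)" by simp
    finally show ?thesis using move[of "s + of_nat j - 1"] by (simp only:)
  qed
  have "(\<lambda>n. of_nat (Suc n) powr (1 - s)) \<longlonglongrightarrow> (0::complex)"
  proof (rule tendsto_norm_zero_cancel)
    have "(\<lambda>n. real n powr (1 - Re s)) \<longlonglongrightarrow> 0"
      using s by (intro tendsto_neg_powr filterlim_real_sequentially) auto
    then show "(\<lambda>n. cmod (of_nat (Suc n) powr (1 - s))) \<longlonglongrightarrow> 0"
      unfolding norm_of_nat_powr by (subst (asm) filterlim_sequentially_Suc[symmetric]) simp
  qed
  from telescope_sums[OF this]
  have t: "(\<lambda>n. of_nat (Suc (Suc n)) powr (1 - s) - of_nat (Suc n) powr (1 - s)) sums (- 1 :: complex)"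
    by simp
  have "(\<lambda>n. of_nat (Suc (Suc n)) powr (1 - s) - of_nat (Suc n) powr (1 - s)
     - (\<Sum>j\<le>K. ((1 - s) gchoose Suc j) * (1 / of_nat (Suc n) powr (s + of_nat j))))
     sums (- 1 - (\<Sum>j\<le>K. ((1 - s) gchoose Suc j) * dirichlet_zeta (s + of_nat j)))"
    using s by (intro sums_diff[OF t] sums_sum sums_mult dirichlet_zeta_sums) auto
  moreover have "of_nat (Suc (Suc n)) powr (1 - s) - of_nat (Suc n) powr (1 - s)
     - (\<Sum>j\<le>K. ((1 - s) gchoose Suc j) * (1 / of_nat (Suc n) powr (s + of_nat j)))
     = zeta_tail K n s" for n
  proof -
    have "1 - s - of_nat (Suc j) = - (s + of_nat j)" for j by simp
    then show ?thesis
      unfolding zeta_tail_def sum.atMost_Suc_shift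
      by (simp only: powr_minus_divide) simp
  qed
  ultimately have "(\<Sum>n. zeta_tail K n s) = - 1 + (\<Sum>j\<le>K. ?c j)"
    unfolding c by (simp add: sums_iff sum_negf)
  also have "(\<Sum>j\<le>K. ?c j) = (s - 1) * dirichlet_zeta s + (\<Sum>j=1..K. ?c j)"
    unfolding atMost_atLeast0 by (subst sum.atLeast_Suc_atMost) simp_all
  finally show ?thesis by (simp del: of_nat_Suc)
qed

text \<open>
  Each use of the recurrence moves the boundary of the domain of \<open>(s - 1) \<zeta>(s)\<close> one unit to the
  left: on \<open>Re s > - (m + 1)\<close> the shifted arguments \<open>s + j\<close> with \<open>j \<ge> 1\<close> lie in the domain reached
  before, and the tails of order \<open>m + 1\<close> converge. The start \<open>m = 0\<close> has no shifted terms at all.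
\<close>

lemma zeta_half_plane_continuation:
  "\<exists>Z. Z holomorphic_on {s. Re s > - real m} \<and> (\<forall>s. Re s > 1 \<longrightarrow> Z s = (s - 1) * dirichlet_zeta s)"
proof (induction m)
  case 0
  show ?case
    using zeta_tail_series(1)[of 0] dirichlet_zeta_shift_recurrence[of _ 0]
    by (intro exI[of _ "\<lambda>s. 1 + (\<Sum>n. zeta_tail 0 n s)"]) (auto intro!: holomorphic_intros)
next
  case (Suc m)
  then obtain Z where Z: "Z holomorphic_on {s. Re s > - real m}"
    and Zd: "\<And>s. Re s > 1 \<Longrightarrow> Z s = (s - 1) * dirichlet_zeta s" by blast
  let ?Z = "\<lambda>s. 1 + (\<Sum>n. zeta_tail (Suc m) n s)
    - (\<Sum>j=1..Suc m. ((1 - s) gchoose j) / of_nat (Suc j) * Z (s + of_nat j))"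
  have sh: "(\<lambda>s. Z (s + of_nat j)) holomorphic_on {s. Re s > - real (Suc m)}" if "j \<ge> 1" for j
  proof -
    have "Z \<circ> (\<lambda>s. s + of_nat j) holomorphic_on {s. Re s > - real (Suc m)}"
      using that by (intro holomorphic_on_compose_gen[OF _ Z]) (auto intro!: holomorphic_intros)
    then show ?thesis by (simp only: o_def)
  qed
  have "?Z holomorphic_on {s. Re s > - real (Suc m)}"
    unfolding gbinomial_prod_rev
    by (intro holomorphic_intros zeta_tail_series(1) sh) (auto simp del: of_nat_Suc)
  moreover have "?Z s = (s - 1) * dirichlet_zeta s" if "Re s > 1" for s
    using that dirichlet_zeta_shift_recurrence[of s "Suc m"] by (simp add: Zd)
  ultimately show ?case by blast
qed

lemma zeta_entire_continuation:
  obtains Z where "Z holomorphic_on UNIV" "\<And>s. Re s > 1 \<Longrightarrow> Z s = (s - 1) * dirichlet_zeta s"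
proof -
  let ?H = "\<lambda>m. {s. Re s > - real m}"
  obtain Z where Z: "\<And>m. Z m holomorphic_on ?H m"
    and Zd: "\<And>m s. Re s > 1 \<Longrightarrow> Z m s = (s - 1) * dirichlet_zeta s"
    using zeta_half_plane_continuation by metis
  have le: "Z m s = Z k s" if "m \<le> k" "s \<in> ?H m" for m k s
  proof (rule analytic_continuation_open[where s = "{s. Re s > 1}" and s' = "?H m"
        and f = "Z m" and g = "Z k" and z = s])
    show "{s. Re s > 1} \<noteq> {}" by (auto intro!: exI[of _ 2])
    show "Z k holomorphic_on ?H m" by (rule holomorphic_on_subset[OF Z[of k]]) (use \<open>m \<le> k\<close> in auto)
    show "connected (?H m)" by (rule convex_connected[OF convex_halfspace_Re_gt])
    show "Z m z = Z k z" if "z \<in> {s. Re s > 1}" for z using that Zd by simp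
  qed (use that in \<open>auto intro: Z open_halfspace_Re_gt\<close>)
  have eq: "Z m s = Z k s" if "s \<in> ?H m" "s \<in> ?H k" for m k s
    using le[of m k s] le[of k m s] that by (metis nle_le)
  \<comment> \<open>Any choice of a half-plane that contains \<open>s\<close> would do, by \<open>eq\<close>.\<close>
  define W where "W = (\<lambda>s. Z (nat \<lceil>1 - Re s\<rceil>) s)"
  have mem: "s \<in> ?H (nat \<lceil>1 - Re s\<rceil>)" for s by simp linarith
  have W: "W s = Z m s" if "s \<in> ?H m" for s m
    unfolding W_def using mem that by (rule eq)
  show thesis
  proof (rule that)
    have "W holomorphic_on (\<Union>m. ?H m)"
    proof (rule holomorphic_on_UN_open)
      show "W holomorphic_on ?H m" for m
        using Z[of m] W by (subst holomorphic_cong[OF refl W]) auto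
    qed (auto simp: open_halfspace_Re_gt)
    moreover have "(\<Union>m. ?H m) = UNIV" using mem by blast
    ultimately show "W holomorphic_on UNIV" by simp
    show "W s = (s - 1) * dirichlet_zeta s" if "Re s > 1" for s
      using W[of s 0] Zd[of s 0] that by simp
  qed
qed

text \<open>
  The definite description behind \<^const>\<open>riemann_zeta\<close> denotes: existence is the continuation
  above divided by \<open>s - 1\<close>, and uniqueness is the identity theorem on the connected punctured plane.
\<close>

lemma riemann_zeta_properties:
  "riemann_zeta holomorphic_on (- {1})"
  "Re s > 1 \<Longrightarrow> (\<lambda>n. 1 / of_nat (Suc n) powr s) sums riemann_zeta s"
  "riemann_zeta 1 = 0"
proof -
  let ?P = "\<lambda>f. f holomorphic_on (- {1}) \<and>
     (\<forall>s. Re s > 1 \<longrightarrow> (\<lambda>n. 1 / of_nat (Suc n) powr s) sums f s) \<and> f 1 = 0"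
  obtain Z where Z: "Z holomorphic_on UNIV" "\<And>s. Re s > 1 \<Longrightarrow> Z s = (s - 1) * dirichlet_zeta s"
    using zeta_entire_continuation by blast
  let ?f = "\<lambda>s. if s = 1 then 0 else Z s / (s - 1)"
  have ex: "?P ?f"
  proof (intro conjI allI impI)
    have "(\<lambda>s. Z s / (s - 1)) holomorphic_on (- {1})"
      by (intro holomorphic_intros holomorphic_on_subset[OF Z(1)]) auto
    then show "?f holomorphic_on (- {1})" by (rule holomorphic_transform) auto
    fix s :: complex assume s: "Re s > 1"
    then have "?f s = dirichlet_zeta s" using Z(2) by auto
    then show "(\<lambda>n. 1 / of_nat (Suc n) powr s) sums ?f s" using dirichlet_zeta_sums[OF s] by simp
  qed simp
  have uniq: "f = g" if f: "?P f" and g: "?P g" for f g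
  proof
    fix s
    show "f s = g s"
    proof (cases "s = 1")
      case False
      show ?thesis
      proof (rule analytic_continuation_open[where s = "{s. Re s > 1}" and s' = "- {1}"
          and f = f and g = g and z = s])
        show "{s. Re s > 1} \<noteq> {}" by (auto intro!: exI[of _ 2])
        show "connected (- {1 :: complex})" by (intro connected_punctured_universe) simp
        show "f z = g z" if "z \<in> {s. Re s > 1}" for z
          using f g that sums_unique2 by blast
      qed (use f g False in \<open>auto simp: open_halfspace_Re_gt\<close>)
    qed (use f g in auto)
  qed
  have "?P riemann_zeta" unfolding riemann_zeta_def
    by (rule theI[where P = ?P, OF ex uniq[OF _ ex]])
  then show "riemann_zeta holomorphic_on (- {1})"
    "Re s > 1 \<Longrightarrow> (\<lambda>n. 1 / of_nat (Suc n) powr s) sums riemann_zeta s"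
    "riemann_zeta 1 = 0" by auto
qed

section \<open>The exponent at which zeta takes the value two\<close>

text \<open>
  The recurrence with \<open>K = 0\<close>, where no shifted values occur, is an explicit formula that holds to
  the left of the line \<open>Re s = 1\<close> as well. It gives access to \<open>\<zeta>\<close> on the interval from \<open>0\<close> to \<open>1\<close>.
\<close>

lemma riemann_zeta_half_plane:
  assumes "Re s > 0" "s \<noteq> 1"
  shows "(s - 1) * riemann_zeta s = 1 + (\<Sum>n. zeta_tail 0 n s)"
proof (rule analytic_continuation_open[where s = "{s. Re s > 1}" and s' = "{s. Re s > 0} - {1}"
      and f = "\<lambda>s. (s - 1) * riemann_zeta s" and g = "\<lambda>s. 1 + (\<Sum>n. zeta_tail 0 n s)" and z = s])
  show "{s. Re s > 1} \<noteq> {}" by (auto intro!: exI[of _ 2])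
  show "connected ({s. Re s > 0} - {1})"
    by (intro connected_open_delete) (auto simp: open_halfspace_Re_gt convex_halfspace_Re_gt intro!: convex_connected)
  show "(\<lambda>s. (s - 1) * riemann_zeta s) holomorphic_on {s. Re s > 0} - {1}"
    by (intro holomorphic_intros holomorphic_on_subset[OF riemann_zeta_properties(1)]) auto
  show "(\<lambda>s. 1 + (\<Sum>n. zeta_tail 0 n s)) holomorphic_on {s. Re s > 0} - {1}"
    by (intro holomorphic_intros holomorphic_on_subset[OF zeta_tail_series(1)]) auto
  fix z assume "z \<in> {s. Re s > 1}"
  then have z: "Re z > 1" by simp
  have "riemann_zeta z = dirichlet_zeta z"
    using riemann_zeta_properties(2)[OF z] dirichlet_zeta_sums[OF z] by (rule sums_unique2)
  then show "(z - 1) * riemann_zeta z = 1 + (\<Sum>n. zeta_tail 0 n z)"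
    using dirichlet_zeta_shift_recurrence[OF z, of 0] by simp
qed (use assms in \<open>auto simp: open_halfspace_Re_gt intro!: open_Diff\<close>)

text \<open>
  Comparison of the sum with the integral of \<open>x powr (- a)\<close>: the number \<open>t\<close> is the sum over \<open>n\<close> of
  \<open>(n + 1) powr (- a)\<close> minus the mean of \<open>x powr (- a)\<close> on \<open>[n + 1, n + 2]\<close>. As this function
  decreases, each summand lies between \<open>0\<close> and \<open>(n + 1) powr (- a) - (n + 2) powr (- a)\<close>, and the
  upper bounds telescope to \<open>1\<close>.
\<close>

lemma riemann_zeta_real_bounds:
  assumes a: "a > 0" "a \<noteq> 1"
  obtains t where "0 \<le> t" "t \<le> 1" "riemann_zeta (of_real a) = of_real (1 / (a - 1) + t)"
proof -
  define u :: "nat \<Rightarrow> real" where "u = (\<lambda>n. real (Suc n) powr (1 - a))"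
  define v where "v = (\<lambda>n. real (Suc n) powr - a - (u (Suc n) - u n) / (1 - a))"
  have v: "0 \<le> v n" "v n \<le> real (Suc n) powr - a - real (Suc (Suc n)) powr - a" for n
  proof -
    have "((\<lambda>x. x powr (1 - a)) has_real_derivative (1 - a) * x powr (1 - a - 1)) (at x)" 
      if "real (Suc n) \<le> x" for x
      by (rule has_real_derivative_powr) (use that in auto)
    then have "\<exists>\<xi>. real (Suc n) < \<xi> \<and> \<xi> < real (Suc (Suc n)) \<and>
        real (Suc (Suc n)) powr (1 - a) - real (Suc n) powr (1 - a)
         = (real (Suc (Suc n)) - real (Suc n)) * ((1 - a) * \<xi> powr (1 - a - 1))"
      by (intro MVT2) auto
    then obtain \<xi> where \<xi>: "real (Suc n) < \<xi>" "\<xi> < real (Suc (Suc n))" "u (Suc n) - u n = (1 - a) * \<xi> powr - a"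
      unfolding u_def by auto
    then have "v n = real (Suc n) powr - a - \<xi> powr - a" using a unfolding v_def by simp
    moreover have "\<xi> powr - a \<le> real (Suc n) powr - a" "real (Suc (Suc n)) powr - a \<le> \<xi> powr - a"
      using a \<xi> by (intro powr_mono2'; simp)+
    ultimately show "0 \<le> v n" "v n \<le> real (Suc n) powr - a - real (Suc (Suc n)) powr - a" by auto
  qed
  have "(\<lambda>n. real n powr - a) \<longlonglongrightarrow> 0"
    using a by (intro tendsto_neg_powr filterlim_real_sequentially) auto
  then have "(\<lambda>n. real (Suc n) powr - a) \<longlonglongrightarrow> 0" by (rule LIMSEQ_Suc)
  from telescope_sums'[OF this]
  have tel: "(\<lambda>n. real (Suc n) powr - a - real (Suc (Suc n)) powr - a) sums 1" by simp
  have sv: "summable v"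
    by (rule summable_comparison_test'[OF sums_summable[OF tel], of 0]) (use v in auto)
  have t0: "0 \<le> suminf v" by (rule suminf_nonneg[OF sv v(1)])
  have t1: "suminf v \<le> 1" using suminf_le[OF v(2) sv sums_summable[OF tel]] tel by (simp add: sums_iff)
  have "zeta_tail 0 n (of_real a) = of_real ((a - 1) * v n)" for n
  proof -
    have p: "complex_of_nat (Suc m) powr (of_real b) = of_real (real (Suc m) powr b)" for m b
      by (subst powr_of_real[symmetric]) auto
    have "zeta_tail 0 n (of_real a) = of_nat (Suc (Suc n)) powr of_real (1 - a)
       - (of_nat (Suc n) powr of_real (1 - a) + (1 - of_real a) * of_nat (Suc n) powr of_real (- a))"
      unfolding zeta_tail_def by simp
    also have "\<dots> = of_real (u (Suc n) - u n - (1 - a) * real (Suc n) powr - a)"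
      unfolding p u_def by simp
    also have "u (Suc n) - u n - (1 - a) * real (Suc n) powr - a = (a - 1) * v n"
      using a unfolding v_def by (simp add: field_simps)
    finally show ?thesis .
  qed
  then have "(of_real a - 1) * riemann_zeta (of_real a) = 1 + (\<Sum>n. complex_of_real ((a - 1) * v n))"
    using riemann_zeta_half_plane[of "of_real a"] a by (simp del: of_real_mult)
  also have "(\<Sum>n. complex_of_real ((a - 1) * v n)) = of_real ((a - 1) * suminf v)"
    unfolding suminf_of_real[OF summable_mult[OF sv, of "a - 1"], symmetric] suminf_mult[OF sv] ..
  also have "1 + complex_of_real ((a - 1) * suminf v) = of_real (1 + (a - 1) * suminf v)" by simp
  also have "1 + (a - 1) * suminf v = (a - 1) * (1 / (a - 1) + suminf v)"
    using a by (simp add: field_simps)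
  finally have "of_real (a - 1) * riemann_zeta (of_real a) = of_real (a - 1) * of_real (1 / (a - 1) + suminf v)"
    by simp
  then have "riemann_zeta (of_real a) = of_real (1 / (a - 1) + suminf v)"
    using a by (subst (asm) mult_left_cancel) (auto simp flip: of_real_diff)
  with t0 t1 show thesis by (rule that)
qed

lemma riemann_zeta_real_sums:
  assumes "a > 1"
  shows "(\<lambda>n. real (Suc n) powr - a) sums Re (riemann_zeta (of_real a))"
    and "riemann_zeta (of_real a) = of_real (Re (riemann_zeta (of_real a)))"
proof -
  have "1 / complex_of_nat (Suc n) powr of_real a = of_real (real (Suc n) powr - a)" for n
    unfolding powr_minus_divide[symmetric] of_real_minus[symmetric]
    by (subst powr_of_real[symmetric]) auto
  then have s: "(\<lambda>n. complex_of_real (real (Suc n) powr - a)) sums riemann_zeta (of_real a)"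
    using riemann_zeta_properties(2)[of "of_real a"] assms by simp
  from sums_Re[OF s] show r: "(\<lambda>n. real (Suc n) powr - a) sums Re (riemann_zeta (of_real a))" by simp
  show "riemann_zeta (of_real a) = of_real (Re (riemann_zeta (of_real a)))"
    by (rule sums_unique2[OF s sums_of_real[OF r]])
qed

text \<open>
  The previous bounds give \<open>\<zeta>(3/2) \<ge> 1 / (1/2) = 2\<close> and \<open>\<zeta>(2) \<le> 1 + 1 = 2\<close>, so the value \<open>2\<close> is attained
  in between. It is attained only once on the positive axis: \<open>\<zeta>\<close> is strictly decreasing beyond
  \<open>1\<close>, the value at \<open>1\<close> is \<open>0\<close> by convention, and for \<open>0 < b < 1\<close> the bounds give
  \<open>\<zeta>(b) \<le> 1 / (b - 1) + 1 < 0\<close>.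
\<close>

lemma alpha0_properties: "\<alpha>\<^sub>0 > 1" "riemann_zeta (of_real \<alpha>\<^sub>0) = 2"
proof -
  let ?z = "\<lambda>a. Re (riemann_zeta (of_real a))"
  have cont: "continuous_on {3/2..2} ?z"
    by (intro continuous_intros continuous_on_compose2[OF
          holomorphic_on_imp_continuous_on[OF riemann_zeta_properties(1)]]) auto
  have lo: "?z (3/2) \<ge> 2"
    by (rule riemann_zeta_real_bounds[of "3/2"]) auto
  have hi: "?z 2 \<le> 2"
    by (rule riemann_zeta_real_bounds[of 2]) auto
  obtain a where a: "3/2 \<le> a" "a \<le> 2" "?z a = 2"
    using IVT2'[of ?z 2 2 "3/2", OF hi lo _ cont] by auto
  have anti: "?z c < ?z b" if "1 < b" "b < c" for b c :: real
  proof -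
    have s: "(\<lambda>n. real (Suc n) powr - b - real (Suc n) powr - c) sums (?z b - ?z c)"
      using that by (intro sums_diff riemann_zeta_real_sums) auto
    have "0 < (\<Sum>n. real (Suc n) powr - b - real (Suc n) powr - c)"
      by (rule suminf_pos2[OF sums_summable[OF s], of 1]) (use that in \<open>auto intro!: powr_mono simp del: powr_minus\<close>)
    then show ?thesis using s by (simp add: sums_iff)
  qed
  have uniq: "b = a" if b: "b > 0" "riemann_zeta (of_real b) = 2" for b
  proof -
    have "b > 1"
    proof (rule ccontr)
      assume "\<not> b > 1"
      moreover have "b \<noteq> 1" using b riemann_zeta_properties(3) by auto
      ultimately have b1: "b < 1" by simp
      obtain t where t: "t \<le> 1" "riemann_zeta (of_real b) = of_real (1 / (b - 1) + t)"
        using riemann_zeta_real_bounds[of b] b b1 by auto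
      have "1 / (b - 1) \<le> - 1" using b b1 by (simp add: field_simps)
      moreover have "1 / (b - 1) + t = 2" using t(2) b(2) by (metis of_real_eq_iff of_real_numeral)
      ultimately show False using t(1) by simp
    qed
    then show ?thesis using anti[of a b] anti[of b a] a b by (cases a b rule: linorder_cases) auto
  qed
  have z: "riemann_zeta (of_real a) = 2"
    using riemann_zeta_real_sums(2)[of a] a by simp
  have "\<alpha>\<^sub>0 = a" unfolding alpha0_def by (rule the_equality) (use a z uniq in auto)
  then show "\<alpha>\<^sub>0 > 1" "riemann_zeta (of_real \<alpha>\<^sub>0) = 2" using a z by auto
qed

text \<open>
  Without its first term \<open>1\<close>, the series for \<open>\<zeta>(\<alpha>\<^sub>0) = 2\<close> has sum exactly \<open>1\<close>. This is what makes
  \<open>\<alpha>\<^sub>0\<close> the right exponent for the induction in the final theorem.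
\<close>

lemma sum_powr_alpha0_le:
  assumes "finite K" "\<And>k. k \<in> K \<Longrightarrow> k \<ge> (2::nat)"
  shows "(\<Sum>k\<in>K. (1 / real k) powr \<alpha>\<^sub>0) \<le> 1"
proof -
  let ?f = "\<lambda>n. real (Suc n) powr - \<alpha>\<^sub>0"
  have s: "?f sums 2"
    using riemann_zeta_real_sums(1)[OF alpha0_properties(1)] alpha0_properties(2) by simp
  let ?I = "insert 0 ((\<lambda>k. k - 1) ` K)"
  have inj: "inj_on (\<lambda>k. k - 1) K"
    using assms(2) by (intro inj_onI) (metis Suc_1 Suc_le_D diff_Suc_1 less_eq_Suc_le)
  have "(\<Sum>k\<in>K. (1 / real k) powr \<alpha>\<^sub>0) = (\<Sum>k\<in>K. ?f (k - 1))"
    using assms(2) by (intro sum.cong refl) (force simp: powr_minus_divide powr_divide)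
  also have "\<dots> = sum ?f ((\<lambda>k. k - 1) ` K)"
    unfolding sum.reindex[OF inj] by (simp only: o_def)
  also have "1 + \<dots> = sum ?f ?I"
    using assms by (subst sum.insert) force+
  also have "sum ?f ?I \<le> suminf ?f"
    using assms(1) by (intro sum_le_suminf sums_summable[OF s]) auto
  also have "suminf ?f = 2" using s by (simp add: sums_iff)
  finally show ?thesis by simp
qed

section \<open>A recursion for the Moebius function\<close>

lemma floor_quotient_le: "d \<preceq>\<^sub>1 n \<Longrightarrow> d \<le> n"
  by (auto simp: floor_quotient_def)

lemma floor_quotient_refl: "n > 0 \<Longrightarrow> n \<preceq>\<^sub>1 n"
  by (auto simp: floor_quotient_def intro!: exI[of _ 1])

text \<open>The reason is \<open>(n div k) div l = n div (k * l)\<close>.\<close>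

lemma floor_quotient_trans: "d \<preceq>\<^sub>1 m \<Longrightarrow> m \<preceq>\<^sub>1 n \<Longrightarrow> d \<preceq>\<^sub>1 n"
  unfolding floor_quotient_def by (metis div_mult2_eq nat_0_less_mult_iff)

text \<open>
  The defining sum solved for its term at \<open>m = n\<close>; as a terminating recursion it provides the
  existence that the definite description presupposes.
\<close>

function floor_quotient_mobius_rec :: "nat \<Rightarrow> nat \<Rightarrow> int" where
  "floor_quotient_mobius_rec d n = (if \<not> d \<preceq>\<^sub>1 n then 0 else if d = n then 1
     else - (\<Sum>m | d \<preceq>\<^sub>1 m \<and> m \<preceq>\<^sub>1 n \<and> m < n. floor_quotient_mobius_rec d m))"
  by auto
termination by (relation "Wellfounded.measure snd") auto

declare floor_quotient_mobius_rec.simps [simp del]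

lemma sum_floor_quotient_interval:
  fixes \<mu> :: "nat \<Rightarrow> int"
  assumes "d \<preceq>\<^sub>1 n"
  shows "(\<Sum>m | d \<preceq>\<^sub>1 m \<and> m \<preceq>\<^sub>1 n. \<mu> m) = \<mu> n + (\<Sum>m | d \<preceq>\<^sub>1 m \<and> m \<preceq>\<^sub>1 n \<and> m < n. \<mu> m)"
proof -
  have "n > 0" using assms by (simp add: floor_quotient_def)
  then have "{m. d \<preceq>\<^sub>1 m \<and> m \<preceq>\<^sub>1 n} = insert n {m. d \<preceq>\<^sub>1 m \<and> m \<preceq>\<^sub>1 n \<and> m < n}"
    using assms floor_quotient_refl floor_quotient_le by (auto simp: le_less)
  then show ?thesis by simp
qed

text \<open>
  The defining sum vanishes also for \<open>d\<close> and \<open>n\<close> that are not comparable: by transitivity it is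
  then empty. This makes the recursion a solution of all the defining equations; that every
  solution satisfies the recursion gives uniqueness.
\<close>

lemma floor_quotient_mobius_eq: "\<mu>\<^sub>1 = floor_quotient_mobius_rec"
  unfolding floor_quotient_mobius_def
proof (rule the_equality, intro conjI allI impI)
  fix n :: nat assume "n > 0"
  then show "floor_quotient_mobius_rec n n = 1"
    by (simp add: floor_quotient_mobius_rec.simps floor_quotient_refl)
next
  fix d n :: nat assume "\<not> d \<preceq>\<^sub>1 n"
  then show "floor_quotient_mobius_rec d n = 0" by (simp add: floor_quotient_mobius_rec.simps)
next
  fix d n :: nat assume "d \<noteq> n"
  show "(\<Sum>m | d \<preceq>\<^sub>1 m \<and> m \<preceq>\<^sub>1 n. floor_quotient_mobius_rec d m) = 0"
  proof (cases "d \<preceq>\<^sub>1 n")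
    case True
    then show ?thesis using \<open>d \<noteq> n\<close>
      by (simp add: sum_floor_quotient_interval floor_quotient_mobius_rec.simps[of d n])
  next
    case False
    then have "{m. d \<preceq>\<^sub>1 m \<and> m \<preceq>\<^sub>1 n} = {}" using floor_quotient_trans by blast
    then show ?thesis by (simp only: sum.empty)
  qed
next
  fix \<mu> :: "nat \<Rightarrow> nat \<Rightarrow> int"
  assume \<mu>: "(\<forall>n>0. \<mu> n n = 1) \<and> (\<forall>d n. \<not> d \<preceq>\<^sub>1 n \<longrightarrow> \<mu> d n = 0) \<and>
     (\<forall>d n. d \<noteq> n \<longrightarrow> (\<Sum>m | d \<preceq>\<^sub>1 m \<and> m \<preceq>\<^sub>1 n. \<mu> d m) = 0)"
  have "\<mu> d n = floor_quotient_mobius_rec d n" for d n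
  proof (induction n rule: less_induct)
    case (less n)
    consider "\<not> d \<preceq>\<^sub>1 n" | "d = n" "n > 0" | "d \<preceq>\<^sub>1 n" "d \<noteq> n"
      by (metis floor_quotient_def)
    then show ?case
    proof cases
      case 3
      then have "\<mu> d n = - (\<Sum>m | d \<preceq>\<^sub>1 m \<and> m \<preceq>\<^sub>1 n \<and> m < n. \<mu> d m)"
        using \<mu> sum_floor_quotient_interval[of d n "\<mu> d"] by simp
      also have "\<dots> = - (\<Sum>m | d \<preceq>\<^sub>1 m \<and> m \<preceq>\<^sub>1 n \<and> m < n. floor_quotient_mobius_rec d m)"
        by (simp add: less)
      finally show ?thesis using 3 by (simp add: floor_quotient_mobius_rec.simps[of d n])
    qed (use \<mu> floor_quotient_refl in \<open>auto simp: floor_quotient_mobius_rec.simps\<close>)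
  qed
  then show "\<mu> = floor_quotient_mobius_rec" by blast
qed

section \<open>The bound\<close>

theorem theorem1p5:
  fixes d n :: nat
  assumes "d > 0" and "n > 0"
  shows "real_of_int \<bar>\<mu>\<^sub>1 d n\<bar> \<le> (real n / real d) powr \<alpha>\<^sub>0"
  unfolding floor_quotient_mobius_eq using assms(2)
proof (induction n rule: less_induct)
  case (less n)
  let ?M = "{m. d \<preceq>\<^sub>1 m \<and> m \<preceq>\<^sub>1 n \<and> m < n}"
  consider "\<not> d \<preceq>\<^sub>1 n" | "d = n" | "d \<preceq>\<^sub>1 n" "d \<noteq> n" by blast
  then show ?case
  proof cases
    case 3
    have fin: "finite ?M" by simp
    \<comment> \<open>Distinct \<open>m\<close> have distinct divisors \<open>k m\<close>, so the sum over \<open>m\<close> becomes a sum over a set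
       of integers from \<open>2\<close> on.\<close>
    have "\<forall>m\<in>?M. \<exists>k\<ge>2. m = n div k"
    proof
      fix m assume "m \<in> ?M"
      then obtain k where k: "k > 0" "m = n div k" "m < n" by (auto simp: floor_quotient_def)
      then have "k \<noteq> 1" by auto
      with k show "\<exists>k\<ge>2. m = n div k" by (intro exI[of _ k]) auto
    qed
    then obtain k where k: "\<And>m. m \<in> ?M \<Longrightarrow> k m \<ge> 2" "\<And>m. m \<in> ?M \<Longrightarrow> m = n div k m" by metis
    have inj: "inj_on k ?M" by (rule inj_onI) (metis k(2))
    have "real_of_int \<bar>floor_quotient_mobius_rec d n\<bar>
        = \<bar>\<Sum>m\<in>?M. real_of_int (floor_quotient_mobius_rec d m)\<bar>"
      using 3 by (simp add: floor_quotient_mobius_rec.simps[of d n])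
    also have "\<dots> \<le> (\<Sum>m\<in>?M. real_of_int \<bar>floor_quotient_mobius_rec d m\<bar>)"
      by (simp add: sum_abs)
    also have "\<dots> \<le> (\<Sum>m\<in>?M. (real n / real d) powr \<alpha>\<^sub>0 * (1 / real (k m)) powr \<alpha>\<^sub>0)"
    proof (rule sum_mono)
      fix m assume m: "m \<in> ?M"
      have "real m \<le> real n / real (k m)"
        using k(2)[OF m] of_nat_div_le_of_nat[of n "k m"] by simp
      then have "real m / real d \<le> real n / real (k m) / real d" by (rule divide_right_mono) simp
      also have "\<dots> = (real n / real d) * (1 / real (k m))" by simp
      finally have le: "real m / real d \<le> (real n / real d) * (1 / real (k m))" .
      have "real_of_int \<bar>floor_quotient_mobius_rec d m\<bar> \<le> (real m / real d) powr \<alpha>\<^sub>0"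
        using m by (intro less.IH) (auto simp: floor_quotient_def)
      also have "\<dots> \<le> ((real n / real d) * (1 / real (k m))) powr \<alpha>\<^sub>0"
        using le alpha0_properties(1) by (intro powr_mono2) auto
      also have "\<dots> = (real n / real d) powr \<alpha>\<^sub>0 * (1 / real (k m)) powr \<alpha>\<^sub>0"
        by (rule powr_mult)
      finally show "real_of_int \<bar>floor_quotient_mobius_rec d m\<bar>
        \<le> (real n / real d) powr \<alpha>\<^sub>0 * (1 / real (k m)) powr \<alpha>\<^sub>0" .
    qed
    also have "\<dots> = (real n / real d) powr \<alpha>\<^sub>0 * (\<Sum>j\<in>k ` ?M. (1 / real j) powr \<alpha>\<^sub>0)"
      by (simp add: sum.reindex[OF inj] sum_distrib_left)
    also have "\<dots> \<le> (real n / real d) powr \<alpha>\<^sub>0 * 1"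
      using fin k(1) by (intro mult_left_mono sum_powr_alpha0_le) auto
    finally show ?thesis by simp
  qed (use less.prems in \<open>auto simp: floor_quotient_mobius_rec.simps\<close>)
qed

end
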